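(* Let $\pi_1,\pi_2$ be possibility distributions on a finite set $\mathcal{X}$, with induced possibility measures $\Pi_1,\Pi_2$ and associated credal sets $\mathcal{M}_1,\mathcal{M}_2$, and let $\overline{P}(A)=\min\{\Pi_1(A),\Pi_2(A)\}$ for all $A\subseteq\mathcal{X}$. If $\mathcal{M}_1\cup\mathcal{M}_2$ is convex, then $\overline{P}$ is coherent.
   Context: $\mathcal{X}$ is a finite set and $\wp(\mathcal{X})$ its power set. A possibility distribution on $\mathcal{X}$ is a function $\pi\colon\mathcal{X}\to[0,1]$ with $\max_{x\in\mathcal{X}}\pi(x)=1$. It induces the possibility measure $\Pi\colon\wp(\mathcal{X})\to[0,1]$, $\Pi(A)=\max_{x\in A}\pi(x)$, with $\Pi(\emptyset)=0$. An upper probability is a function $\overline{P}\colon\wp(\mathcal{X})\to[0,1]$. Its credal set is the set of all (finitely additive) probability measures $Q$ on $\wp(\mathcal{X})$ with $Q(A)\le\overline{P}(A)$ for all $A\subseteq\mathcal{X}$. $\overline{P}$ avoids sure loss if its credal set $\mathcal{M}$ is non-empty; in that case its natural extension is $\overline{E}(A)=\max_{Q\in\mathcal{M}}Q(A)$ for $A\subseteq\mathcal{X}$. $\overline{P}$ is coherent if it avoids sure loss and $\overline{P}(A)=\overline{E}(A)$ for all $A\subseteq\mathcal{X}$. *)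

theory Defs
  imports "HOL-Analysis.Analysis"
begin

text \<open>
  The finite set is the universe of a type \<open>'a::finite\<close>, so that set functions on its power
  set have type \<open>'a set \<Rightarrow> real\<close>.
\<close>

definition possibility_distribution :: "('a::finite \<Rightarrow> real) \<Rightarrow> bool" where
  "possibility_distribution \<pi> \<longleftrightarrow> (\<forall>x. \<pi> x \<in> {0..1}) \<and> Max (range \<pi>) = 1"

definition possibility_measure :: "('a::finite \<Rightarrow> real) \<Rightarrow> 'a set \<Rightarrow> real" where
  "possibility_measure \<pi> A = (if A = {} then 0 else Max (\<pi> ` A))"

definition probability :: "('a::finite set \<Rightarrow> real) \<Rightarrow> bool" where
  "probability Q \<longleftrightarrow> (\<forall>A. 0 \<le> Q A) \<and> Q UNIV = 1 \<and>
     (\<forall>A B. A \<inter> B = {} \<longrightarrow> Q (A \<union> B) = Q A + Q B)"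

definition credal_set :: "('a::finite set \<Rightarrow> real) \<Rightarrow> ('a set \<Rightarrow> real) set" where
  "credal_set P = {Q. probability Q \<and> (\<forall>A. Q A \<le> P A)}"

definition avoids_sure_loss :: "('a::finite set \<Rightarrow> real) \<Rightarrow> bool" where
  "avoids_sure_loss P \<longleftrightarrow> credal_set P \<noteq> {}"

text \<open>
  The maximum ranges over an infinite set in general, so \<open>Max\<close> is not applicable. It exists
  whenever the credal set is non-empty; see \<open>natural_extension_max\<close> below.
\<close>

definition natural_extension :: "('a::finite set \<Rightarrow> real) \<Rightarrow> 'a set \<Rightarrow> real" where
  "natural_extension P A = (GREATEST r. \<exists>Q\<in>credal_set P. r = Q A)"

definition coherent :: "('a::finite set \<Rightarrow> real) \<Rightarrow> bool" where
  "coherent P \<longleftrightarrow> avoids_sure_loss P \<and> (\<forall>A. P A = natural_extension P A)"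

text \<open>
  Functions do not form a \<^class>\<open>real_vector\<close> in the library. To speak about convexity,
  a set function is read as a vector indexed by the (finitely many) events.
\<close>

definition convex_set_functions :: "('a::finite set \<Rightarrow> real) set \<Rightarrow> bool" where
  "convex_set_functions M \<longleftrightarrow> convex ((\<lambda>Q. \<chi> A. Q A) ` M :: (real ^ 'a set) set)"

lemma convex_set_functions_iff:
  "convex_set_functions M \<longleftrightarrow>
     (\<forall>Q\<in>M. \<forall>R\<in>M. \<forall>u\<ge>0. \<forall>v\<ge>0. u + v = 1 \<longrightarrow> (\<lambda>A. u * Q A + v * R A) \<in> M)"
proof -
  have comb: "u *\<^sub>R (\<chi> A. Q A) + v *\<^sub>R (\<chi> A. R A) = (\<chi> A. u * Q A + v * R A)"
    for u v and Q R :: "'a set \<Rightarrow> real"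
    by (simp add: vec_eq_iff)
  have "inj (\<lambda>Q :: 'a set \<Rightarrow> real. \<chi> A. Q A)"
    by (rule injI) (simp only: vec_lambda_inject[OF UNIV_I UNIV_I])
  note mem = inj_image_mem_iff[OF this]
  show ?thesis
    unfolding convex_set_functions_def convex_def ball_simps(9) comb mem ..
qed

lemma probability_le_1:
  assumes "probability Q" shows "Q A \<le> 1"
proof -
  have "Q (A \<union> - A) = Q A + Q (- A)" "0 \<le> Q (- A)" "Q UNIV = 1"
    using assms Compl_disjoint[of A] unfolding probability_def by blast+
  then show ?thesis by simp
qed

lemma compact_credal_set: "compact ((\<lambda>Q. \<chi> A. Q A) ` credal_set P :: (real ^ 'a::finite set) set)"
proof -
  let ?S = "(\<lambda>Q. \<chi> A. Q A) ` credal_set P :: (real ^ 'a set) set"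
  have S: "?S = {q. (\<forall>A. 0 \<le> q $ A) \<and> q $ UNIV = 1 \<and>
      (\<forall>A B. A \<inter> B = {} \<longrightarrow> q $ (A \<union> B) = q $ A + q $ B) \<and> (\<forall>A. q $ A \<le> P A)}" (is "_ = ?T")
  proof
    show "?S \<subseteq> ?T"
      by (simp add: image_subset_iff credal_set_def probability_def)
    show "?T \<subseteq> ?S"
    proof
      fix q assume "q \<in> ?T"
      then have "($) q \<in> credal_set P"
        by (simp add: credal_set_def probability_def)
      moreover have "q = (\<chi> A. q $ A)" by simp
      ultimately show "q \<in> ?S" by blast
    qed
  qed
  have "closed {q :: real ^ 'a set. A \<inter> B = {} \<longrightarrow> q $ (A \<union> B) = q $ A + q $ B}" for A B
    by (cases "A \<inter> B = {}") (simp_all add: closed_Collect_eq continuous_on_add continuous_on_component)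
  then have "closed ?T"
    by (intro closed_Collect_conj closed_Collect_all closed_Collect_le closed_Collect_eq
        continuous_on_const continuous_on_component continuous_on_id) assumption
  then have "closed ?S" by (simp only: S)
  have "?S \<subseteq> cbox 0 1"
    by (simp add: image_subset_iff mem_box_cart credal_set_def probability_le_1)
      (simp add: probability_def)
  then have "bounded ?S" by (rule bounded_subset[OF bounded_cbox])
  with \<open>closed ?S\<close> show ?thesis by (simp only: compact_eq_bounded_closed)
qed

lemma natural_extension_max:
  assumes "avoids_sure_loss P"
  shows "\<exists>Q\<in>credal_set P. natural_extension P A = Q A \<and> (\<forall>R\<in>credal_set P. R A \<le> Q A)"
proof -
  let ?S = "(\<lambda>Q. \<chi> A. Q A) ` credal_set P :: (real ^ 'a set) set"
  have "\<exists>q\<in>?S. \<forall>r\<in>?S. r $ A \<le> q $ A"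
    using assms by (intro continuous_attains_sup compact_credal_set continuous_intros)
      (auto simp: avoids_sure_loss_def)
  then obtain Q where Q: "Q \<in> credal_set P" "\<forall>R\<in>credal_set P. R A \<le> Q A" by auto
  then have "natural_extension P A = Q A"
    unfolding natural_extension_def by (intro Greatest_equality) auto
  with Q show ?thesis by blast
qed

end

theory Submission
  imports Defs
begin

text \<open>
  The credal set of \<open>min P\<^sub>1 P\<^sub>2\<close> is \<open>M\<^sub>1 \<inter> M\<^sub>2\<close>, so coherence asks that every event \<open>A\<close> have some
  \<open>Q \<in> M\<^sub>1 \<inter> M\<^sub>2\<close> with \<open>Q A \<ge> min (P\<^sub>1 A) (P\<^sub>2 A)\<close>. Possibility measures are themselves coherent,
  with explicit two-point masses as maximisers
  (\<open>possibility_measure_attained\<close>). Take \<open>Q\<^sub>i \<in> M\<^sub>i\<close> with \<open>Q\<^sub>i A = P\<^sub>i A\<close>. If \<open>M\<^sub>1 \<union> M\<^sub>2\<close> is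
  convex, it contains the segment from \<open>Q\<^sub>1\<close> to \<open>Q\<^sub>2\<close>; this segment is connected, and it is covered
  by the closed sets \<open>M\<^sub>1\<close> and \<open>M\<^sub>2\<close>, both of which it meets. Hence some point \<open>Q\<close> of it lies in
  \<open>M\<^sub>1 \<inter> M\<^sub>2\<close>. As a convex combination of \<open>P\<^sub>1 A\<close> and \<open>P\<^sub>2 A\<close>, the value \<open>Q A\<close> is at least their
  minimum. This last argument concerns arbitrary coherent upper probabilities
  (\<open>coherent_min_if_convex_union\<close>).
\<close>

lemma coherent_iff_dominated_attained:
  "coherent P \<longleftrightarrow> (\<forall>A. \<exists>Q\<in>credal_set P. P A \<le> Q A)"
proof
  assume "coherent P"
  then show "\<forall>A. \<exists>Q\<in>credal_set P. P A \<le> Q A"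
    using natural_extension_max[of P] unfolding coherent_def by (metis order_refl)
next
  assume att: "\<forall>A. \<exists>Q\<in>credal_set P. P A \<le> Q A"
  then have asl: "avoids_sure_loss P"
    unfolding avoids_sure_loss_def by blast
  have "P A = natural_extension P A" for A
  proof -
    obtain Q where Q: "Q \<in> credal_set P" "natural_extension P A = Q A"
      "\<forall>R\<in>credal_set P. R A \<le> Q A"
      using natural_extension_max[OF asl] by blast
    have "Q A \<le> P A" using Q(1) by (simp add: credal_set_def)
    moreover have "P A \<le> Q A" using att Q(3) by (meson order_trans)
    ultimately show ?thesis using Q(2) by simp
  qed
  with asl show "coherent P" by (simp add: coherent_def)
qed

lemma credal_set_min: "credal_set (\<lambda>A. min (P A) (R A)) = credal_set P \<inter> credal_set R"
  by (auto simp: credal_set_def)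

text \<open>
  Two closed sets whose union is convex cannot be separated along a segment joining them.
\<close>

lemma convex_Un_credal_sets_crossing:
  assumes conv: "convex_set_functions (credal_set P\<^sub>1 \<union> credal_set P\<^sub>2)"
    and Q1: "Q\<^sub>1 \<in> credal_set P\<^sub>1" and Q2: "Q\<^sub>2 \<in> credal_set P\<^sub>2"
  obtains Q u where "Q \<in> credal_set P\<^sub>1" "Q \<in> credal_set P\<^sub>2" "0 \<le> u" "u \<le> 1"
    "\<And>A. Q A = (1 - u) * Q\<^sub>1 A + u * Q\<^sub>2 A"
proof -
  let ?v = "\<lambda>Q :: 'a set \<Rightarrow> real. \<chi> A. Q A"
  let ?S = "closed_segment (?v Q\<^sub>1) (?v Q\<^sub>2)"
  have "?S \<subseteq> ?v ` (credal_set P\<^sub>1 \<union> credal_set P\<^sub>2)"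
    using conv Q1 Q2 unfolding convex_set_functions_def
    by (intro closed_segment_subset) auto
  then have cover: "?S \<subseteq> ?v ` credal_set P\<^sub>1 \<union> ?v ` credal_set P\<^sub>2"
    by (simp only: image_Un)
  have "connected ?S" by simp
  moreover have "closed (?v ` credal_set P\<^sub>1)" "closed (?v ` credal_set P\<^sub>2)"
    by (simp_all only: compact_credal_set compact_imp_closed)
  moreover have "?v ` credal_set P\<^sub>1 \<inter> ?S \<noteq> {}" "?v ` credal_set P\<^sub>2 \<inter> ?S \<noteq> {}"
    using Q1 Q2 by blast+
  ultimately have "?v ` credal_set P\<^sub>1 \<inter> ?v ` credal_set P\<^sub>2 \<inter> ?S \<noteq> {}"
    using cover unfolding connected_closed by blast
  then obtain Q R where QR: "Q \<in> credal_set P\<^sub>1" "R \<in> credal_set P\<^sub>2" "?v Q = ?v R" "?v Q \<in> ?S"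
    by blast
  have "Q = R" using QR(3) by (simp add: vec_eq_iff fun_eq_iff)
  moreover obtain u where "0 \<le> u" "u \<le> 1" "?v Q = (1 - u) *\<^sub>R ?v Q\<^sub>1 + u *\<^sub>R ?v Q\<^sub>2"
    using QR(4) by (auto simp: in_segment)
  moreover from this have "Q A = (1 - u) * Q\<^sub>1 A + u * Q\<^sub>2 A" for A
    by (simp add: vec_eq_iff)
  ultimately show thesis using QR(1,2) that by blast
qed

lemma coherent_min_if_convex_union:
  assumes "coherent P\<^sub>1" "coherent P\<^sub>2"
    and conv: "convex_set_functions (credal_set P\<^sub>1 \<union> credal_set P\<^sub>2)"
  shows "coherent (\<lambda>A. min (P\<^sub>1 A) (P\<^sub>2 A))"
  unfolding coherent_iff_dominated_attained credal_set_min
proof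
  fix A
  obtain Q\<^sub>1 Q\<^sub>2 where Q1: "Q\<^sub>1 \<in> credal_set P\<^sub>1" "P\<^sub>1 A \<le> Q\<^sub>1 A"
    and Q2: "Q\<^sub>2 \<in> credal_set P\<^sub>2" "P\<^sub>2 A \<le> Q\<^sub>2 A"
    using assms(1,2) unfolding coherent_iff_dominated_attained by blast
  obtain Q u where Q: "Q \<in> credal_set P\<^sub>1" "Q \<in> credal_set P\<^sub>2" and u: "0 \<le> u" "u \<le> 1"
    and QA: "Q A = (1 - u) * Q\<^sub>1 A + u * Q\<^sub>2 A"
    using convex_Un_credal_sets_crossing[OF conv Q1(1) Q2(1)] by blast
  let ?m = "min (P\<^sub>1 A) (P\<^sub>2 A)"
  have "?m = (1 - u) * ?m + u * ?m" by (simp add: algebra_simps)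
  also have "\<dots> \<le> Q A"
    unfolding QA using u Q1(2) Q2(2) by (intro add_mono mult_left_mono) auto
  finally show "\<exists>Q\<in>credal_set P\<^sub>1 \<inter> credal_set P\<^sub>2. ?m \<le> Q A"
    using Q by blast
qed

text \<open>
  With \<open>\<pi> x = Max (\<pi> ` A)\<close> and \<open>\<pi> z = 1\<close>, the mass \<open>\<pi> x\<close> at \<open>x \<in> A\<close> and the rest at \<open>z\<close> work: an
  event containing \<open>z\<close> has possibility 1, and any other event receives \<open>\<pi> x\<close> if it contains \<open>x\<close>,
  so has possibility at least \<open>\<pi> x\<close>, and receives nothing otherwise.
\<close>

lemma possibility_measure_attained:
  assumes "possibility_distribution \<pi>"
  shows "\<exists>Q\<in>credal_set (possibility_measure \<pi>). possibility_measure \<pi> A \<le> Q A"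
proof -
  have bounds: "0 \<le> \<pi> y" "\<pi> y \<le> 1" for y
    using assms by (auto simp: possibility_distribution_def)
  obtain z where z: "\<pi> z = 1"
    using assms Max_in[of "range \<pi>"] unfolding possibility_distribution_def by auto
  have upper: "\<pi> y \<le> possibility_measure \<pi> B" if "y \<in> B" for y B
    using that by (auto simp: possibility_measure_def)
  have nonneg: "0 \<le> possibility_measure \<pi> B" for B
  proof (cases "B = {}")
    case False
    then obtain y where "y \<in> B" by blast
    then show ?thesis using order_trans[OF bounds(1) upper] by blast
  qed (simp add: possibility_measure_def)
  \<comment> \<open>The empty event has possibility 0, so any point serves as \<open>x\<close> then.\<close>
  obtain x where x: "A \<noteq> {} \<longrightarrow> x \<in> A \<and> possibility_measure \<pi> A = \<pi> x"
  proof (cases "A = {}")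
    case False
    then have "Max (\<pi> ` A) \<in> \<pi> ` A" by (intro Max_in) auto
    then obtain x where "x \<in> A" "Max (\<pi> ` A) = \<pi> x" by blast
    with False that show thesis by (simp add: possibility_measure_def)
  qed (use that in blast)
  define Q where "Q B = \<pi> x * of_bool (x \<in> B) + (1 - \<pi> x) * of_bool (z \<in> B)" for B
  have "probability Q"
    unfolding probability_def Q_def using bounds[of x] by (auto simp: algebra_simps)
  moreover have "Q B \<le> possibility_measure \<pi> B" for B
  proof (cases "z \<in> B")
    case True
    have "Q B \<le> 1" using True bounds by (simp add: Q_def of_bool_def)
    with upper[OF True] z show ?thesis by simp
  next
    case False
    then show ?thesis using upper nonneg by (simp add: Q_def of_bool_def)
  qed
  moreover have "possibility_measure \<pi> A \<le> Q A"
    using x bounds by (cases "A = {}") (auto simp: Q_def possibility_measure_def)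
  ultimately show ?thesis by (auto simp: credal_set_def)
qed

theorem proposition4:
  fixes \<pi>\<^sub>1 \<pi>\<^sub>2 :: "'a::finite \<Rightarrow> real"
  assumes "possibility_distribution \<pi>\<^sub>1" and "possibility_distribution \<pi>\<^sub>2"
    and "convex_set_functions
      (credal_set (possibility_measure \<pi>\<^sub>1) \<union> credal_set (possibility_measure \<pi>\<^sub>2))"
  shows "coherent (\<lambda>A. min (possibility_measure \<pi>\<^sub>1 A) (possibility_measure \<pi>\<^sub>2 A))"
  using assms possibility_measure_attained
  by (intro coherent_min_if_convex_union) (auto simp: coherent_iff_dominated_attained)

end
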